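(* Assume the Slater condition: there exists $\hat x\in\mathbb{R}^n$ with $f_i(\hat x)<0$ for all $i=1,\dots,m$. Let $\{x^k\}$ be the sequence generated by PACA (the algorithm described in the context) starting from an arbitrary point $x^0\in\mathbb{R}^n$. If $\{x^k\}$ is infinite, then it converges to some $x^\star\in C$.
   Context: Setting. $m,n\ge 1$; $f_i:\mathbb{R}^n\to\mathbb{R}$ is convex for $i=1,\dots,m$; $C_i=\{x\in\mathbb{R}^n: f_i(x)\le 0\}$ and $C=\bigcap_{i=1}^m C_i$. $\|\cdot\|$ is the Euclidean norm and $\partial f_i(x)$ is the convex subdifferential. $\{\epsilon_k\}_{k\ge 0}$ is a decreasing sequence of positive reals ($\epsilon_{k+1}<\epsilon_k$) converging to $0$. PACA (Perturbed Approximate Circumcenter Algorithm). Start from $x^0\in\mathbb{R}^n$. Given $x^k$: if $x^k\in C$, stop. Otherwise choose arbitrary $u_i^k\in\partial f_i(x^k)$ for $i=1,\dots,m$, and set $$v_i^k=\frac{\max\{0,f_i(x^k)+\epsilon_k\}}{\|u_i^k\|^2}\,u_i^k,\qquad w^k=\frac1m\sum_{i=1}^m v_i^k .$$ If $w^k=0$, put $x^{k+1}=x^k$ and go to iteration $k+1$. Otherwise put $$\alpha_k=\frac{\frac1m\sum_{i=1}^m\|v_i^k\|^2}{\|w^k\|^2},\qquad x^{k+1}=x^k-\alpha_k w^k .$$ Here $v_i^k=0$ whenever $f_i(x^k)+\epsilon_k\le 0$, and it is understood that the iterates are well defined, i.e. $u_i^k\ne 0$ whenever $f_i(x^k)+\epsilon_k>0$.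 The sequence is called infinite if the algorithm never stops, i.e. $x^k\notin C$ for all $k$. *)

theory Defs
  imports "HOL-Analysis.Analysis"
begin

definition subdifferential :: "('a::real_inner \<Rightarrow> real) \<Rightarrow> 'a \<Rightarrow> 'a set" where
  "subdifferential g x = {u. \<forall>y. g y \<ge> g x + u \<bullet> (y - x)}"

definition feasible_set :: "nat \<Rightarrow> (nat \<Rightarrow> 'a \<Rightarrow> real) \<Rightarrow> 'a set" where
  "feasible_set m f = (\<Inter>i\<in>{1..m}. {x. f i x \<le> 0})"

text \<open>In the following, \<open>e\<close> is the current perturbation, \<open>x\<close> the current iterate and \<open>u i\<close> the
  subgradient chosen for \<open>f i\<close> at \<open>x\<close>. If \<open>f i x + e \<le> 0\<close>, then \<open>paca_v\<close> is \<open>0\<close> for every \<open>u i\<close>,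
  including \<open>u i = 0\<close> (division by \<open>0\<close> yields \<open>0\<close>).\<close>

definition paca_v ::
    "(nat \<Rightarrow> 'a::real_inner \<Rightarrow> real) \<Rightarrow> real \<Rightarrow> 'a \<Rightarrow> (nat \<Rightarrow> 'a) \<Rightarrow> nat \<Rightarrow> 'a" where
  "paca_v f e x u i = (max 0 (f i x + e) / (norm (u i))\<^sup>2) *\<^sub>R u i"

definition paca_w ::
    "nat \<Rightarrow> (nat \<Rightarrow> 'a::real_inner \<Rightarrow> real) \<Rightarrow> real \<Rightarrow> 'a \<Rightarrow> (nat \<Rightarrow> 'a) \<Rightarrow> 'a" where
  "paca_w m f e x u = (1 / real m) *\<^sub>R (\<Sum>i=1..m. paca_v f e x u i)"

definition paca_alpha ::
    "nat \<Rightarrow> (nat \<Rightarrow> 'a::real_inner \<Rightarrow> real) \<Rightarrow> real \<Rightarrow> 'a \<Rightarrow> (nat \<Rightarrow> 'a) \<Rightarrow> real" where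
  "paca_alpha m f e x u =
     ((1 / real m) * (\<Sum>i=1..m. (norm (paca_v f e x u i))\<^sup>2)) / (norm (paca_w m f e x u))\<^sup>2"

definition paca_next ::
    "nat \<Rightarrow> (nat \<Rightarrow> 'a::real_inner \<Rightarrow> real) \<Rightarrow> real \<Rightarrow> 'a \<Rightarrow> (nat \<Rightarrow> 'a) \<Rightarrow> 'a" where
  "paca_next m f e x u =
     (if paca_w m f e x u = 0 then x
      else x - paca_alpha m f e x u *\<^sub>R paca_w m f e x u)"

text \<open>The iterates are \<open>x 0, x 1, \<dots>\<close> up to and including the first one in the feasible set, where
  the algorithm stops; the values of \<open>x\<close> beyond that index are irrelevant and left unconstrained.
  The subgradients \<open>u k i\<close> are arbitrary, subject to the iterates being well defined, i.e.
  \<open>u k i \<noteq> 0\<close> whenever the division by its squared norm matters.\<close>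

definition paca_sequence ::
    "nat \<Rightarrow> (nat \<Rightarrow> 'a::real_inner \<Rightarrow> real) \<Rightarrow> (nat \<Rightarrow> real) \<Rightarrow> (nat \<Rightarrow> nat \<Rightarrow> 'a) \<Rightarrow> (nat \<Rightarrow> 'a) \<Rightarrow> bool"
  where
  "paca_sequence m f eps u x \<longleftrightarrow>
     (\<forall>k. (\<forall>j\<le>k. x j \<notin> feasible_set m f) \<longrightarrow>
        (\<forall>i\<in>{1..m}. u k i \<in> subdifferential (f i) (x k) \<and>
                     (f i (x k) + eps k > 0 \<longrightarrow> u k i \<noteq> 0)) \<and>
        x (Suc k) = paca_next m f (eps k) (x k) (u k))"

definition paca_infinite :: "nat \<Rightarrow> (nat \<Rightarrow> 'a \<Rightarrow> real) \<Rightarrow> (nat \<Rightarrow> 'a) \<Rightarrow> bool" where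
  "paca_infinite m f x \<longleftrightarrow> (\<forall>k. x k \<notin> feasible_set m f)"

end

theory Submission
  imports Defs
begin

text \<open>
  The proof rests on two properties of a single step, stated relative to a point \<open>y\<close> that satisfies
  the perturbed constraints \<open>f i y + e \<le> 0\<close>. The subgradient inequality makes \<open>v i\<close> the
  displacement of \<open>x\<close> from a half-space containing \<open>y\<close>, so \<open>\<parallel>v i\<parallel>\<^sup>2 \<le> v i \<bullet> (x - y)\<close>. Averaging, the
  new point \<open>x - \<alpha> w\<close> is the projection of \<open>x\<close> onto a half-space that still contains \<open>y\<close>. Hence
  the step does not increase the distance to \<open>y\<close> (\<open>half_space_step_closer\<close>), and since \<open>\<alpha>\<close> is a
  ratio of a mean of squares to the square of a mean, the step is at least as long as the root mean
  square of the \<open>v i\<close> (\<open>mean_square_le_step\<close>).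

  By the Slater condition and continuity, a whole ball of points \<open>y\<close> satisfies all the perturbed
  constraints once the perturbation is small. The sequence is eventually Fejer monotone with respect
  to this ball, and monotonicity with respect to a set with interior points forces finite length,
  hence convergence (\<open>fejer_ball_convergent\<close>).

  The steps then tend to \<open>0\<close>, and with them all the \<open>v i\<close>. Feasibility of the limit follows by
  overshooting: the subgradient inequality at \<open>x + v i\<close> reads
  \<open>f i (x + v i) \<ge> f i x + max 0 (f i x + e)\<close>. By continuity this becomes
  \<open>f i z \<ge> f i z + max 0 (f i z)\<close> at the limit \<open>z\<close> of the sequence, hence \<open>f i z \<le> 0\<close>.
\<close>

section \<open>Fejer monotone sequences\<close>

text \<open>Comparing the distances to the point of the ball that lies furthest in the direction opposite
  to a step shows that the squared distance to the centre drops by at least \<open>2 r\<close> times the length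
  of that step; these drops sum to a finite total.\<close>

lemma fejer_ball_convergent:
  fixes x :: "nat \<Rightarrow> 'a::{real_inner,banach}"
  assumes r: "r > 0"
    and fejer: "\<And>k y. k \<ge> K \<Longrightarrow> y \<in> cball c r \<Longrightarrow> dist (x (Suc k)) y \<le> dist (x k) y"
  shows "convergent x"
proof -
  define d where "d k = x (Suc (k + K)) - x (k + K)" for k
  define D where "D k = (norm (x (k + K) - c))\<^sup>2" for k
  have drop: "2 * r * norm (d k) \<le> D k - D (Suc k)" for k
  proof -
    define y where "y = c - r *\<^sub>R sgn (d k)"
    have "y \<in> cball c r"
      using r by (simp add: y_def dist_norm norm_sgn)
    then have "dist (x (Suc (k + K))) y \<le> dist (x (k + K)) y"
      by (intro fejer) auto
    then have "(norm (x (Suc (k + K)) - y))\<^sup>2 \<le> (norm (x (k + K) - y))\<^sup>2"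
      by (simp add: dist_norm power_mono)
    moreover have "(norm (z - y))\<^sup>2
        = (norm (z - c))\<^sup>2 + 2 * r * (sgn (d k) \<bullet> (z - c)) + (norm (r *\<^sub>R sgn (d k)))\<^sup>2" for z
      unfolding power2_norm_eq_inner
      by (simp add: y_def inner_diff inner_commute algebra_simps)
    moreover have "sgn (d k) \<bullet> d k = norm (d k)"
      by (cases "d k = 0")
        (simp_all add: sgn_div_norm power2_norm_eq_inner[symmetric] power2_eq_square)
    then have "2 * r * norm (d k)
        = 2 * r * (sgn (d k) \<bullet> (x (Suc (k + K)) - c)) - 2 * r * (sgn (d k) \<bullet> (x (k + K) - c))"
      by (simp add: d_def inner_diff algebra_simps)
    ultimately show ?thesis
      by (simp add: D_def)
  qed
  have "(\<Sum>k<n. norm (d k)) \<le> D 0 / (2 * r)" for n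
  proof -
    have "2 * r * (\<Sum>k<n. norm (d k)) \<le> (\<Sum>k<n. D k - D (Suc k))"
      unfolding sum_distrib_left by (intro sum_mono drop)
    also have "\<dots> = D 0 - D n"
      by (rule sum_lessThan_telescope')
    also have "\<dots> \<le> D 0"
      by (simp add: D_def)
    finally show ?thesis
      using r by (simp add: field_simps)
  qed
  then have "summable (\<lambda>k. norm (d k))"
    by (intro summableI_nonneg_bounded) auto
  then have "summable d"
    by (rule summable_norm_cancel)
  then have "convergent (\<lambda>n. \<Sum>k<n. d k)"
    by (simp only: summable_iff_convergent)
  then have "convergent (\<lambda>n. x K + (\<Sum>k<n. d k))"
    by (rule convergent_add[OF convergent_const])
  moreover have "x K + (\<Sum>k<n. d k) = x (n + K)" for n
    by (induction n) (simp_all add: d_def algebra_simps)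
  ultimately have "convergent (\<lambda>n. x (n + K))"
    by simp
  then show ?thesis
    by (rule convergent_ignore_initial_segment[THEN iffD1])
qed

section \<open>One step of the method\<close>

text \<open>For \<open>w \<noteq> 0\<close>, the point \<open>x - (s / \<parallel>w\<parallel>\<^sup>2) w\<close> is the projection of \<open>x\<close> onto the half-space
  \<open>{z. s \<le> w \<bullet> (x - z)}\<close>, which contains \<open>y\<close>; projections do not increase distances.\<close>

lemma half_space_step_closer:
  fixes x y w :: "'a::real_inner"
  assumes "0 \<le> s" and "s \<le> w \<bullet> (x - y)"
  shows "dist (x - (s / (norm w)\<^sup>2) *\<^sub>R w) y \<le> dist x y"
proof (cases "w = 0")
  case False
  define a where "a = s / (norm w)\<^sup>2"
  have a: "a \<ge> 0" "a * (norm w)\<^sup>2 = s"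
    using False assms(1) by (auto simp: a_def)
  have "(norm (x - a *\<^sub>R w - y))\<^sup>2
      = (norm (x - y))\<^sup>2 - 2 * a * (w \<bullet> (x - y)) + a * (a * (norm w)\<^sup>2)"
    by (simp add: power2_norm_eq_inner inner_diff inner_commute algebra_simps)
  also have "\<dots> = (norm (x - y))\<^sup>2 - a * (w \<bullet> (x - y)) - a * (w \<bullet> (x - y) - s)"
    by (simp add: a algebra_simps)
  also have "\<dots> \<le> (norm (x - y))\<^sup>2"
  proof -
    have "0 \<le> a * (w \<bullet> (x - y))" "0 \<le> a * (w \<bullet> (x - y) - s)"
      using a assms by (auto intro!: mult_nonneg_nonneg)
    then show ?thesis
      by linarith
  qed
  finally show ?thesis
    by (simp add: dist_norm a_def flip: abs_le_square_iff)
qed simp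

lemma norm_mean_squared_le:
  fixes v :: "'b \<Rightarrow> 'a::real_normed_vector"
  assumes "finite I" and "I \<noteq> {}"
  shows "(norm ((1 / real (card I)) *\<^sub>R (\<Sum>i\<in>I. v i)))\<^sup>2
    \<le> (1 / real (card I)) * (\<Sum>i\<in>I. (norm (v i))\<^sup>2)"
proof -
  have "(norm (\<Sum>i\<in>I. v i))\<^sup>2 \<le> (\<Sum>i\<in>I. norm (v i))\<^sup>2"
    by (intro power_mono norm_sum) simp
  also have "\<dots> \<le> (\<Sum>i\<in>I. (norm (v i))\<^sup>2) * real (card I)"
    by (rule sum_squared_le_sum_of_squares)
  finally have "(norm (\<Sum>i\<in>I. v i))\<^sup>2 / (real (card I))\<^sup>2
      \<le> ((\<Sum>i\<in>I. (norm (v i))\<^sup>2) * real (card I)) / (real (card I))\<^sup>2"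
    by (intro divide_right_mono) auto
  then show ?thesis
    using assms by (simp add: power_divide power2_eq_square[of "real _"])
qed

text \<open>If \<open>\<parallel>w\<parallel>\<^sup>2 \<le> s\<close>, as for the mean \<open>w\<close> and the mean square \<open>s\<close> of a family, the step length
  \<open>s / \<parallel>w\<parallel>\<close> is at least \<open>sqrt s\<close>.\<close>

lemma mean_square_le_step:
  fixes w :: "'a::real_normed_vector"
  assumes "w \<noteq> 0" and "(norm w)\<^sup>2 \<le> s"
  shows "s \<le> (norm ((s / (norm w)\<^sup>2) *\<^sub>R w))\<^sup>2"
proof -
  define a where "a = s / (norm w)\<^sup>2"
  have s: "s = a * (norm w)\<^sup>2"
    using assms(1) by (simp add: a_def)
  have "a \<ge> 1"
    using assms by (simp add: a_def)
  then have "a * 1 \<le> a * a"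
    by (intro mult_left_mono) auto
  then have "a * (norm w)\<^sup>2 \<le> a\<^sup>2 * (norm w)\<^sup>2"
    by (intro mult_right_mono) (auto simp: power2_eq_square)
  also have "\<dots> = (norm (a *\<^sub>R w))\<^sup>2"
    by (simp add: power_mult_distrib)
  finally show ?thesis
    unfolding a_def[symmetric] s[symmetric] .
qed

text \<open>If \<open>v \<noteq> 0\<close>, the hyperplane through \<open>x - v\<close> orthogonal to \<open>v\<close> is the zero set of the
  linearization of \<open>f i + e\<close> at \<open>x\<close>. The linearization minorizes \<open>f i + e\<close>, so it is nonpositive at
  \<open>y\<close>, which places \<open>y\<close> beyond that hyperplane as seen from \<open>x\<close>.\<close>

lemma paca_v_cut:
  assumes sub: "u i \<in> subdifferential (f i) x"
    and nz: "f i x + e > 0 \<Longrightarrow> u i \<noteq> 0"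
    and y: "f i y + e \<le> 0"
  shows "(norm (paca_v f e x u i))\<^sup>2 \<le> paca_v f e x u i \<bullet> (x - y)"
proof (cases "f i x + e > 0")
  case True
  define g where "g = f i x + e"
  have g: "g > 0" and u: "u i \<noteq> 0"
    using True nz by (auto simp: g_def)
  have v: "paca_v f e x u i = (g / (norm (u i))\<^sup>2) *\<^sub>R u i"
    using True by (simp add: paca_v_def g_def)
  have "f i y \<ge> f i x + u i \<bullet> (y - x)"
    using sub by (simp add: subdifferential_def)
  then have "g \<le> u i \<bullet> (x - y)"
    using y by (simp add: g_def inner_diff_right)
  then have "(g / (norm (u i))\<^sup>2) * g \<le> (g / (norm (u i))\<^sup>2) * (u i \<bullet> (x - y))"
    using g by (intro mult_left_mono) auto
  moreover have "(norm (paca_v f e x u i))\<^sup>2 = (g / (norm (u i))\<^sup>2) * g"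
    using u by (simp add: v power2_eq_square)
  ultimately show ?thesis
    by (simp add: v)
qed (simp add: paca_v_def)

text \<open>The subgradient inequality at the point \<open>x + v\<close>, the mirror image of the projection of \<open>x\<close>
  onto the linearized constraint. It converts smallness of \<open>v\<close> into smallness of the constraint
  violation whatever the size of the subgradient.\<close>

lemma paca_v_overshoot:
  assumes sub: "u i \<in> subdifferential (f i) x"
    and nz: "f i x + e > 0 \<Longrightarrow> u i \<noteq> 0"
  shows "f i x + max 0 (f i x + e) \<le> f i (x + paca_v f e x u i)"
proof -
  have "u i \<bullet> paca_v f e x u i = max 0 (f i x + e)"
    using nz by (cases "f i x + e > 0") (auto simp: paca_v_def power2_norm_eq_inner)
  moreover have "f i (x + paca_v f e x u i) \<ge> f i x + u i \<bullet> (x + paca_v f e x u i - x)"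
    using sub unfolding subdifferential_def by blast
  ultimately show ?thesis
    by simp
qed

text \<open>The cuts at \<open>y\<close> average to \<open>s \<le> w \<bullet> (x - y)\<close> with \<open>s\<close> the mean square of the \<open>paca_v\<close>, so
  the facts on half-spaces and means apply. An existing \<open>y\<close> also rules out the degenerate case
  \<open>w = 0\<close> away from the feasible set: then \<open>s = 0\<close>, no perturbed constraint is violated, and \<open>x\<close>
  would be feasible.\<close>

lemma paca_next_step:
  assumes m: "m \<ge> 1" and e: "e > 0" and x: "x \<notin> feasible_set m f"
    and sub: "\<And>i. i \<in> {1..m} \<Longrightarrow> u i \<in> subdifferential (f i) x"
    and nz: "\<And>i. i \<in> {1..m} \<Longrightarrow> f i x + e > 0 \<Longrightarrow> u i \<noteq> 0"
    and y: "\<And>i. i \<in> {1..m} \<Longrightarrow> f i y + e \<le> 0"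
  shows paca_next_closer: "dist (paca_next m f e x u) y \<le> dist x y"
    and paca_next_long: "\<And>i. i \<in> {1..m} \<Longrightarrow>
      (norm (paca_v f e x u i))\<^sup>2 \<le> real m * (norm (paca_next m f e x u - x))\<^sup>2"
proof -
  define v where "v = paca_v f e x u"
  define w where "w = paca_w m f e x u"
  define s where "s = (1 / real m) * (\<Sum>i=1..m. (norm (v i))\<^sup>2)"
  have s0: "s \<ge> 0"
    by (simp add: s_def sum_nonneg)
  have v_le: "(norm (v i))\<^sup>2 \<le> real m * s" if "i \<in> {1..m}" for i
    using m that member_le_sum[of i "{1..m}" "\<lambda>i. (norm (v i))\<^sup>2"] by (simp add: s_def)
  have s_le: "s \<le> w \<bullet> (x - y)"
  proof -
    have "(\<Sum>i=1..m. (norm (v i))\<^sup>2) \<le> (\<Sum>i=1..m. v i \<bullet> (x - y))"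
      unfolding v_def by (intro sum_mono paca_v_cut sub nz y) auto
    then show ?thesis
      unfolding s_def w_def paca_w_def v_def
      by (simp add: inner_sum_left divide_right_mono)
  qed
  have w0: "w \<noteq> 0"
  proof
    assume "w = 0"
    then have "s = 0"
      using s_le s0 by simp
    then have v0: "v i = 0" if "i \<in> {1..m}" for i
      using v_le[OF that] by simp
    have "f i x \<le> 0" if "i \<in> {1..m}" for i
      using paca_v_overshoot[of u i f x e, OF sub[OF that] nz[OF that]] v0[OF that] e by (simp add: v_def)
    then show False
      using x by (simp add: feasible_set_def)
  qed
  have "paca_alpha m f e x u = s / (norm w)\<^sup>2"
    by (simp add: paca_alpha_def s_def v_def w_def)
  then have "next": "paca_next m f e x u = x - (s / (norm w)\<^sup>2) *\<^sub>R w"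
    using w0 by (simp add: paca_next_def w_def)
  show "dist (paca_next m f e x u) y \<le> dist x y"
    unfolding "next" by (rule half_space_step_closer[OF s0 s_le])
  have "(norm w)\<^sup>2 \<le> s"
    using norm_mean_squared_le[of "{1..m}" v] m by (simp add: w_def paca_w_def s_def v_def)
  then have "s \<le> (norm (paca_next m f e x u - x))\<^sup>2"
    using mean_square_le_step[OF w0] by (simp add: "next")
  then show "(norm (paca_v f e x u i))\<^sup>2 \<le> real m * (norm (paca_next m f e x u - x))\<^sup>2"
    if "i \<in> {1..m}" for i
    using v_le[OF that] by (fold v_def) (meson mult_left_mono of_nat_0_le_iff order_trans)
qed

section \<open>Convergence\<close>

text \<open>Half of the slack at the Slater point absorbs the variation of \<open>f i\<close>, the other half absorbs
  the perturbation.\<close>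

lemma slater_ball:
  fixes f :: "nat \<Rightarrow> 'a::metric_space \<Rightarrow> real"
  assumes cont: "\<And>i. i \<in> {1..m} \<Longrightarrow> isCont (f i) c"
    and neg: "\<And>i. i \<in> {1..m} \<Longrightarrow> f i c < 0"
    and eps: "eps \<longlonglongrightarrow> 0"
  shows "\<exists>r>0. \<exists>K. \<forall>k\<ge>K. \<forall>y\<in>cball c r. \<forall>i\<in>{1..m}. f i y + eps k \<le> 0"
proof -
  have "eventually (\<lambda>y. \<forall>i\<in>{1..m}. f i y < f i c / 2) (nhds c)"
    using cont neg
    by (intro eventually_ball_finite ballI order_tendstoD(2)[where y = "f _ c"])
      (auto simp: isCont_def tendsto_at_iff_tendsto_nhds)
  then obtain d where d: "d > 0" "\<And>y i. dist y c < d \<Longrightarrow> i \<in> {1..m} \<Longrightarrow> f i y < f i c / 2"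
    by (auto simp: eventually_nhds_metric)
  have "eventually (\<lambda>k. \<forall>i\<in>{1..m}. eps k < - f i c / 2) sequentially"
    using neg by (intro eventually_ball_finite ballI order_tendstoD(2)[OF eps]) auto
  then obtain K where K: "\<forall>k\<ge>K. \<forall>i\<in>{1..m}. eps k < - f i c / 2"
    unfolding eventually_sequentially ..
  have "f i y + eps k \<le> 0" if "k \<ge> K" "y \<in> cball c (d / 2)" "i \<in> {1..m}" for k y i
  proof -
    have "dist y c < d"
      using that(2) d(1) by (simp add: dist_commute)
    then show ?thesis
      using d(2)[OF _ that(3)] K[rule_format, OF that(1,3)] by fastforce
  qed
  moreover have "d / 2 > 0"
    using d(1) by simp
  ultimately show ?thesis
    by blast
qed

theorem theorem4p6:
  fixes m :: nat
    and f :: "nat \<Rightarrow> real ^ 'n \<Rightarrow> real"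
    and eps :: "nat \<Rightarrow> real"
    and u :: "nat \<Rightarrow> nat \<Rightarrow> real ^ 'n"
    and x :: "nat \<Rightarrow> real ^ 'n"
  assumes "m \<ge> 1"
    and "\<And>i. i \<in> {1..m} \<Longrightarrow> convex_on UNIV (f i)"
    and "\<And>k. eps k > 0"
    and "\<And>k. eps (Suc k) < eps k"
    and "eps \<longlonglongrightarrow> 0"
    and "\<exists>xhat. \<forall>i\<in>{1..m}. f i xhat < 0"
    and "paca_sequence m f eps u x"
    and "paca_infinite m f x"
  shows "\<exists>xstar\<in>feasible_set m f. x \<longlonglongrightarrow> xstar"
proof -
  have infeas: "x k \<notin> feasible_set m f" for k
    using assms(8) by (simp add: paca_infinite_def)
  have run: "(\<forall>i\<in>{1..m}. u k i \<in> subdifferential (f i) (x k)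
        \<and> (f i (x k) + eps k > 0 \<longrightarrow> u k i \<noteq> 0))
      \<and> x (Suc k) = paca_next m f (eps k) (x k) (u k)" for k
    using assms(7)[unfolded paca_sequence_def, THEN spec, of k]
    by (rule mp) (simp add: infeas)
  have step: "x (Suc k) = paca_next m f (eps k) (x k) (u k)" for k
    using run by (rule conjunct2)
  have sub: "u k i \<in> subdifferential (f i) (x k)" if "i \<in> {1..m}" for i k
    using run[THEN conjunct1, rule_format, OF that] by (rule conjunct1)
  have nz: "u k i \<noteq> 0" if "i \<in> {1..m}" "f i (x k) + eps k > 0" for i k
    using run[THEN conjunct1, rule_format, OF that(1), THEN conjunct2] that(2) by (rule mp)
  have cont: "isCont (f i) z" if "i \<in> {1..m}" for i z
    using convex_on_continuous[OF open_UNIV assms(2)[OF that]]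
    by (simp add: continuous_on_eq_continuous_at)
  obtain c where "\<And>i. i \<in> {1..m} \<Longrightarrow> f i c < 0"
    using assms(6) by blast
  then have "\<exists>r>0. \<exists>K. \<forall>k\<ge>K. \<forall>y\<in>cball c r. \<forall>i\<in>{1..m}. f i y + eps k \<le> 0"
    using cont assms(5) by (intro slater_ball)
  then obtain r K where r: "r > 0"
    and ball: "\<forall>k\<ge>K. \<forall>y\<in>cball c r. \<forall>i\<in>{1..m}. f i y + eps k \<le> 0"
    by auto
  have "dist (x (Suc k)) y \<le> dist (x k) y" if "k \<ge> K" "y \<in> cball c r" for k y
    unfolding step
    using paca_next_closer[OF assms(1,3) infeas sub nz ball[rule_format, OF that]] .
  then have "convergent x"
    by (rule fejer_ball_convergent[OF r])
  then obtain z where z: "x \<longlonglongrightarrow> z"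
    by (auto simp: convergent_def)
  have "f i z \<le> 0" if i: "i \<in> {1..m}" for i
  proof -
    define v where "v k = paca_v f (eps k) (x k) (u k) i" for k
    have "norm ((norm (v k))\<^sup>2) \<le> real m * (norm (x (Suc k) - x k))\<^sup>2" if "k \<ge> K" for k
      using paca_next_long[OF assms(1,3) infeas sub nz ball[rule_format, OF that, of c] i] r
      by (simp add: step v_def)
    then have "eventually (\<lambda>k. norm ((norm (v k))\<^sup>2) \<le> real m * (norm (x (Suc k) - x k))\<^sup>2)
        sequentially"
      by (rule eventually_sequentiallyI)
    moreover have "(\<lambda>k. real m * (norm (x (Suc k) - x k))\<^sup>2) \<longlonglongrightarrow> 0"
    proof -
      have "(\<lambda>k. real m * (norm (x (Suc k) - x k))\<^sup>2) \<longlonglongrightarrow> real m * (norm (z - z))\<^sup>2"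
        by (intro tendsto_mult tendsto_const tendsto_power tendsto_norm tendsto_diff LIMSEQ_Suc z)
      then show ?thesis
        by simp
    qed
    ultimately have "(\<lambda>k. (norm (v k))\<^sup>2) \<longlonglongrightarrow> 0"
      by (rule Lim_null_comparison)
    then have "(\<lambda>k. sqrt ((norm (v k))\<^sup>2)) \<longlonglongrightarrow> sqrt 0"
      by (rule tendsto_real_sqrt)
    then have "v \<longlonglongrightarrow> 0"
      by (simp add: tendsto_norm_zero_iff)
    from tendsto_add[OF z this] have "(\<lambda>k. x k + v k) \<longlonglongrightarrow> z"
      by simp
    then have right: "(\<lambda>k. f i (x k + v k)) \<longlonglongrightarrow> f i z"
      by (rule isCont_tendsto_compose[OF cont[OF i]])
    have left: "(\<lambda>k. f i (x k) + max 0 (f i (x k) + eps k)) \<longlonglongrightarrow> f i z + max 0 (f i z + 0)"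
      by (intro tendsto_add tendsto_max tendsto_const isCont_tendsto_compose[OF cont[OF i] z] assms(5))
    have "\<exists>N. \<forall>k\<ge>N. f i (x k) + max 0 (f i (x k) + eps k) \<le> f i (x k + v k)"
      unfolding v_def by (intro exI[of _ 0] allI impI paca_v_overshoot[where f = f] sub[OF i] nz[OF i])
    then have "f i z + max 0 (f i z + 0) \<le> f i z"
      by (rule LIMSEQ_le[OF left right])
    then show ?thesis
      by simp
  qed
  then have "z \<in> feasible_set m f"
    by (simp add: feasible_set_def)
  then show ?thesis
    using z by blast
qed

end
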